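(* Let $d\ge 1$ and suppose $L\subset\mathbb{R}^d$ has all pairwise distances distinct and has no infinite descending chains. Let $M$ be the stable matching of $L$ and consider friendly frogs on $L$. For distinct $x,y\in L$, the position with the two frogs at $x$ and $y$ is a P-position if and only if $x$ is matched to $y$ in $M$ (that is, $\{x,y\}\in M$).
   Context: $|\cdot|$ is the Euclidean norm. "All pairwise distances distinct" means $|x-y|\ne|u-v|$ whenever $\{x,y\}\neq\{u,v\}$ are unordered pairs of distinct points of $L$. An infinite descending chain in $L$ is an infinite sequence $x_1,x_2,\ldots\in L$ such that $(|x_i-x_{i+1}|)_{i\ge1}$ is strictly decreasing, consecutive points being distinct. Friendly frogs on $L$: in a two-frog position the two (identical) frogs occupy two distinct points of $L$. Players alternate; a move consists of moving either one of the two frogs to another point of $L$ so that the distance between the frogs strictly decreases and they do not occupy the same point. A player who cannot move loses. A P-position is a position from which the game is a loss for the player whose turn it is to move (the other player has a winning strategy); all other positions are N-positions. A matching of $L$ is a set $M$ of unordered pairs of distinct points of $L$ such that each point of $L$ is in at most one pair. If $\{x,y\}\in M$ write $M(x)=y$; if $x$ is in no pair, write $M(x)=\infty$ and $|x-M(x)|:=\infty$. A pair of distinct points $x,y\in L$ is unstable if $|x-M(x)|$ and $|y-M(y)|$ are both strictly greater than $|x-y|$. $M$ is stable if there are no unstable pairs. Under the stated assumptions on $L$, it is known that there exists a unique stable matching of $L$. *)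

theory Defs
  imports "HOL-Analysis.Analysis"
begin

section \<open>Pairs of points and distances\<close>

definition point_pairs :: "'a set \<Rightarrow> 'a set set" where
  "point_pairs L = {{x, y} | x y. x \<in> L \<and> y \<in> L \<and> x \<noteq> y}"

definition distinct_distances :: "'a::metric_space set \<Rightarrow> bool" where
  "distinct_distances L \<longleftrightarrow>
     (\<forall>x\<in>L. \<forall>y\<in>L. \<forall>u\<in>L. \<forall>v\<in>L.
        x \<noteq> y \<longrightarrow> u \<noteq> v \<longrightarrow> {x, y} \<noteq> {u, v} \<longrightarrow> dist x y \<noteq> dist u v)"

definition infinite_descending_chain :: "'a::metric_space set \<Rightarrow> (nat \<Rightarrow> 'a) \<Rightarrow> bool" where
  "infinite_descending_chain L x \<longleftrightarrow>
     (\<forall>i. x i \<in> L) \<and> (\<forall>i. x i \<noteq> x (Suc i)) \<and>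
     (\<forall>i. dist (x (Suc i)) (x (Suc (Suc i))) < dist (x i) (x (Suc i)))"

section \<open>Stable matchings\<close>

definition matching :: "'a set \<Rightarrow> 'a set set \<Rightarrow> bool" where
  "matching L M \<longleftrightarrow>
     M \<subseteq> point_pairs L \<and> (\<forall>x\<in>L. \<forall>e\<in>M. \<forall>f\<in>M. x \<in> e \<longrightarrow> x \<in> f \<longrightarrow> e = f)"

text \<open>\<open>None\<close> is the value \<open>M(x) = \<infinity>\<close> at an unmatched point.\<close>

definition partner :: "'a set set \<Rightarrow> 'a \<Rightarrow> 'a option" where
  "partner M x = (if \<exists>y. {x, y} \<in> M then Some (THE y. {x, y} \<in> M) else None)"

definition match_dist :: "'a::metric_space set set \<Rightarrow> 'a \<Rightarrow> ereal" where
  "match_dist M x = (case partner M x of None \<Rightarrow> \<infinity> | Some y \<Rightarrow> ereal (dist x y))"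

definition unstable_pair :: "'a::metric_space set \<Rightarrow> 'a set set \<Rightarrow> 'a \<Rightarrow> 'a \<Rightarrow> bool" where
  "unstable_pair L M x y \<longleftrightarrow>
     x \<in> L \<and> y \<in> L \<and> x \<noteq> y \<and>
     match_dist M x > ereal (dist x y) \<and> match_dist M y > ereal (dist x y)"

definition stable_matching :: "'a::metric_space set \<Rightarrow> 'a set set \<Rightarrow> bool" where
  "stable_matching L M \<longleftrightarrow> matching L M \<and> (\<nexists>x y. unstable_pair L M x y)"

section \<open>Winning strategies under normal play\<close>

text \<open>
  A game is given by its move relation \<open>mv\<close> on positions; two players alternate, and a player
  who cannot move loses. A history is the nonempty list of positions visited so far, starting
  position included. The second player is thus to move exactly after histories of even length.
\<close>

definition play :: "('p \<Rightarrow> 'p \<Rightarrow> bool) \<Rightarrow> 'p \<Rightarrow> 'p list \<Rightarrow> bool" where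
  "play mv p ps \<longleftrightarrow>
     ps \<noteq> [] \<and> hd ps = p \<and> (\<forall>i. Suc i < length ps \<longrightarrow> mv (ps ! i) (ps ! Suc i))"

definition infinite_play :: "('p \<Rightarrow> 'p \<Rightarrow> bool) \<Rightarrow> 'p \<Rightarrow> (nat \<Rightarrow> 'p) \<Rightarrow> bool" where
  "infinite_play mv p f \<longleftrightarrow> f 0 = p \<and> (\<forall>i. mv (f i) (f (Suc i)))"

definition can_move :: "('p \<Rightarrow> 'p \<Rightarrow> bool) \<Rightarrow> 'p \<Rightarrow> bool" where
  "can_move mv p \<longleftrightarrow> (\<exists>q. mv p q)"

definition strategy :: "('p \<Rightarrow> 'p \<Rightarrow> bool) \<Rightarrow> ('p list \<Rightarrow> 'p) \<Rightarrow> bool" where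
  "strategy mv \<sigma> \<longleftrightarrow>
     (\<forall>ps. ps \<noteq> [] \<longrightarrow> can_move mv (last ps) \<longrightarrow> mv (last ps) (\<sigma> ps))"

definition second_follows :: "('p list \<Rightarrow> 'p) \<Rightarrow> 'p list \<Rightarrow> bool" where
  "second_follows \<sigma> ps \<longleftrightarrow>
     (\<forall>i. odd i \<longrightarrow> Suc i < length ps \<longrightarrow> ps ! Suc i = \<sigma> (take (Suc i) ps))"

definition second_follows_forever :: "('p list \<Rightarrow> 'p) \<Rightarrow> (nat \<Rightarrow> 'p) \<Rightarrow> bool" where
  "second_follows_forever \<sigma> f \<longleftrightarrow>
     (\<forall>i. odd i \<longrightarrow> f (Suc i) = \<sigma> (map f [0..<Suc i]))"

text \<open>
  A strategy wins for the second player if every play in which she follows it comes to an end,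
  and does so with the first player unable to move.
\<close>

definition wins_second :: "('p \<Rightarrow> 'p \<Rightarrow> bool) \<Rightarrow> 'p \<Rightarrow> ('p list \<Rightarrow> 'p) \<Rightarrow> bool" where
  "wins_second mv p \<sigma> \<longleftrightarrow>
     strategy mv \<sigma> \<and>
     (\<forall>ps. play mv p ps \<longrightarrow> second_follows \<sigma> ps \<longrightarrow> \<not> can_move mv (last ps) \<longrightarrow> odd (length ps)) \<and>
     (\<nexists>f. infinite_play mv p f \<and> second_follows_forever \<sigma> f)"

section \<open>Friendly frogs\<close>

text \<open>The frogs are identical, so a position is the unordered pair of occupied points.\<close>

definition frog_move :: "'a::metric_space set \<Rightarrow> 'a set \<Rightarrow> 'a set \<Rightarrow> bool" where
  "frog_move L p q \<longleftrightarrow>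
     (\<exists>x y z. x \<in> L \<and> y \<in> L \<and> x \<noteq> y \<and> p = {x, y} \<and>
        z \<in> L \<and> z \<noteq> x \<and> z \<noteq> y \<and> q = {z, y} \<and> dist z y < dist x y)"

definition P_position :: "'a::metric_space set \<Rightarrow> 'a set \<Rightarrow> bool" where
  "P_position L p \<longleftrightarrow> p \<in> point_pairs L \<and> (\<exists>\<sigma>. wins_second (frog_move L) p \<sigma>)"

end

theory Submission
  imports Defs
begin

text \<open>
  No matched pair can be moved to a matched pair, because the two would share a point; and
  stability says exactly that an unmatched pair can be moved to a matched one. So once play is
  known to terminate, \<open>M\<close> is the kernel of the game. For termination: without infinite descending
  chains a subset of a Heine-Borel space meets every ball in a finite set, so a frog cannot be
  moved forever while the other rests, and in an infinite play the resting places of the frogs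
  would form an infinite descending chain.
\<close>

section \<open>Kernels and winning strategies\<close>

lemma no_infinite_play:
  assumes "wf {(q, p). mv p q}"
  shows "\<not> infinite_play mv p f"
  using assms by (auto simp: wf_iff_no_infinite_down_chain infinite_play_def)

text \<open>The winning strategy always moves back into \<open>K\<close>: the first player must
  leave \<open>K\<close>, and \<open>absorbing\<close> supplies the way back. The set
  \<open>D\<close> of genuine positions is needed because \<open>absorbing\<close> may fail for
  arbitrary elements of the position type.\<close>

lemma wins_second_in_kernel:
  assumes wf: "wf {(q, p). mv p q}"
    and closed: "\<And>p q. p \<in> D \<Longrightarrow> mv p q \<Longrightarrow> q \<in> D"
    and independent: "\<And>p q. p \<in> K \<Longrightarrow> mv p q \<Longrightarrow> q \<notin> K"
    and absorbing: "\<And>p. p \<in> D \<Longrightarrow> p \<notin> K \<Longrightarrow> \<exists>q\<in>K. mv p q"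
    and p: "p \<in> D" "p \<in> K"
  shows "\<exists>\<sigma>. wins_second mv p \<sigma>"
proof -
  \<comment> \<open>The second branch serves only \<open>strategy\<close>, which asks for a legal
    move after every history, even one from which \<open>K\<close> cannot be reached.\<close>
  define \<tau> where
    "\<tau> r = (if \<exists>q\<in>K. mv r q then SOME q. q \<in> K \<and> mv r q else SOME q. mv r q)" for r
  have \<tau>_kernel: "\<tau> r \<in> K" if "r \<in> D" "r \<notin> K" for r
    using absorbing[OF that] someI_ex[of "\<lambda>q. q \<in> K \<and> mv r q"] by (auto simp: \<tau>_def)
  have \<tau>_move: "mv r (\<tau> r)" if "mv r q" for r q
    using that someI_ex[of "\<lambda>q. q \<in> K \<and> mv r q"] someI[of "mv r" q]
    by (auto simp: \<tau>_def)
  define \<sigma> where "\<sigma> ps = \<tau> (last ps)" for ps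
  have "strategy mv \<sigma>"
    using \<tau>_move by (auto simp: strategy_def can_move_def \<sigma>_def)
  moreover have "odd (length ps)"
    if play: "play mv p ps" and follows: "second_follows \<sigma> ps"
      and stuck: "\<not> can_move mv (last ps)" for ps
  proof -
    have ps: "ps \<noteq> []" "ps ! 0 = p"
      and mv: "\<And>i. Suc i < length ps \<Longrightarrow> mv (ps ! i) (ps ! Suc i)"
      using play by (auto simp: play_def hd_conv_nth)
    have "ps ! i \<in> D \<and> (ps ! i \<in> K \<longleftrightarrow> even i)" if "i < length ps" for i
      using that
    proof (induction i)
      case 0
      then show ?case using ps p by simp
    next
      case (Suc i)
      then have IH: "ps ! i \<in> D" "ps ! i \<in> K \<longleftrightarrow> even i" by auto
      have "ps ! Suc i = \<tau> (ps ! i)" if "odd i"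
        using follows Suc.prems that
        by (simp add: second_follows_def \<sigma>_def take_Suc_conv_app_nth)
      then show ?case
        using IH mv[OF Suc.prems] closed independent \<tau>_kernel by auto
    qed
    \<comment> \<open>The last index is \<open>length ps - 1\<close>, so an even length would end
      the play outside \<open>K\<close>, where a move exists.\<close>
    from this[of "length ps - 1"] ps
    have "last ps \<in> D" "last ps \<in> K \<longleftrightarrow> odd (length ps)"
      by (auto simp: last_conv_nth)
    then show ?thesis
      using absorbing stuck by (auto simp: can_move_def)
  qed
  ultimately show ?thesis
    using no_infinite_play[OF wf] by (auto simp: wins_second_def)
qed

text \<open>A winning strategy stays winning two moves later, once the two past positions are put in
  front of every history.\<close>

lemma wins_second_after_reply:
  assumes wf: "wf {(q, p). mv p q}"
    and wins: "wins_second mv p \<sigma>" and mv: "mv p q"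
  shows "mv q (\<sigma> [p, q])"
    and "wins_second mv (\<sigma> [p, q]) (\<lambda>ps. \<sigma> (p # q # ps))"
proof -
  have strategy: "strategy mv \<sigma>"
    and odd: "\<And>ps. play mv p ps \<Longrightarrow> second_follows \<sigma> ps \<Longrightarrow>
                \<not> can_move mv (last ps) \<Longrightarrow> odd (length ps)"
    using wins by (auto simp: wins_second_def)
  \<comment> \<open>Otherwise \<open>[p, q]\<close> would be a finished play of even length.\<close>
  have "can_move mv q"
    using odd[of "[p, q]"] mv by (auto simp: play_def second_follows_def)
  then show reply: "mv q (\<sigma> [p, q])"
    using strategy by (auto simp: strategy_def dest: spec[of _ "[p, q]"])
  have "odd (length ps)"
    if play: "play mv (\<sigma> [p, q]) ps" and follows: "second_follows (\<lambda>ps. \<sigma> (p # q # ps)) ps"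
      and stuck: "\<not> can_move mv (last ps)" for ps
  proof -
    have ps: "ps \<noteq> []" "ps ! 0 = \<sigma> [p, q]"
      using play by (auto simp: play_def hd_conv_nth)
    have "play mv p (p # q # ps)"
      using play mv reply ps by (auto simp: play_def nth_Cons split: nat.split)
    moreover have "second_follows \<sigma> (p # q # ps)"
      unfolding second_follows_def
    proof (intro allI impI)
      fix i assume i: "odd i" "Suc i < length (p # q # ps)"
      show "(p # q # ps) ! Suc i = \<sigma> (take (Suc i) (p # q # ps))"
      \<comment> \<open>Index 1 is the reply \<open>\<sigma> [p, q]\<close> itself; later odd
        indices shift down by two.\<close>
      proof (cases "i = 1")
        case True
        then show ?thesis using ps by simp
      next
        case False
        then obtain j where j: "i = Suc (Suc j)" "odd j"
          using i(1) by (metis One_nat_def even_Suc even_zero old.nat.exhaust)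
        then show ?thesis using follows i(2) by (simp add: second_follows_def)
      qed
    qed
    ultimately show ?thesis
      using odd[of "p # q # ps"] stuck ps by auto
  qed
  moreover have "strategy mv (\<lambda>ps. \<sigma> (p # q # ps))"
    using strategy unfolding strategy_def by (metis last_ConsR list.distinct(1))
  ultimately show "wins_second mv (\<sigma> [p, q]) (\<lambda>ps. \<sigma> (p # q # ps))"
    using no_infinite_play[OF wf] by (auto simp: wins_second_def)
qed

text \<open>The first player moves into \<open>K\<close> and any reply leaves it again, so a winning
  strategy would survive at a position two moves further on. Hence the induction along the
  transitive closure of the move relation.\<close>

lemma not_wins_second_outside_kernel:
  assumes wf: "wf {(q, p). mv p q}"
    and closed: "\<And>p q. p \<in> D \<Longrightarrow> mv p q \<Longrightarrow> q \<in> D"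
    and independent: "\<And>p q. p \<in> K \<Longrightarrow> mv p q \<Longrightarrow> q \<notin> K"
    and absorbing: "\<And>p. p \<in> D \<Longrightarrow> p \<notin> K \<Longrightarrow> \<exists>q\<in>K. mv p q"
    and "p \<in> D" "p \<notin> K"
  shows "\<not> wins_second mv p \<sigma>"
  using wf_trancl[OF wf] \<open>p \<in> D\<close> \<open>p \<notin> K\<close>
proof (induction p arbitrary: \<sigma> rule: wf_induct_rule)
  case (less p)
  show ?case
  proof
    assume wins: "wins_second mv p \<sigma>"
    obtain q where q: "q \<in> K" "mv p q"
      using absorbing less.prems by blast
    note r = wins_second_after_reply[OF wf wins q(2)]
    have "(\<sigma> [p, q], p) \<in> {(q, p). mv p q}\<^sup>+"
      using r(1) q(2) by (auto intro: trancl_trans)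
    moreover have "\<sigma> [p, q] \<in> D" "\<sigma> [p, q] \<notin> K"
      using closed independent q r(1) less.prems by blast+
    ultimately show False
      using less.IH r(2) by blast
  qed
qed

section \<open>Termination\<close>

lemma limit_point_imp_infinite_descending_chain:
  fixes a :: "'a::metric_space"
  assumes "a islimpt L"
  shows "\<exists>c. infinite_descending_chain L c"
proof -
  have near: "\<exists>y\<in>L. y \<noteq> a \<and> dist y a < e" if "e > 0" for e
    using assms that by (simp add: islimpt_approachable)
  have "\<exists>c. \<forall>n. (c n \<in> L \<and> c n \<noteq> a) \<and> 4 * dist (c (Suc n)) a < dist (c n) a"
  proof (rule dependent_nat_choice)
    show "\<exists>x. x \<in> L \<and> x \<noteq> a"
      using near[of 1] by auto
    show "\<exists>y. (y \<in> L \<and> y \<noteq> a) \<and> 4 * dist y a < dist x a" if "x \<in> L \<and> x \<noteq> a" for x n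
      using near[of "dist x a / 4"] that by auto
  qed
  then obtain c where c: "\<And>n. c n \<in> L"
      and decr: "\<And>n. 4 * dist (c (Suc n)) a < dist (c n) a"
    by blast
  \<comment> \<open>With \<open>r\<close> the distance of \<open>c (Suc n)\<close> from
    \<open>a\<close>, the left side is below \<open>5/4 * r\<close> and the right side above
    \<open>3 * r\<close>.\<close>
  have "dist (c (Suc n)) (c (Suc (Suc n))) < dist (c n) (c (Suc n))" for n
    using decr[of n] decr[of "Suc n"] dist_triangle2[of "c (Suc n)" "c (Suc (Suc n))" a]
      dist_triangle[of "c n" a "c (Suc n)"] zero_le_dist[of "c (Suc (Suc n))" a]
    by linarith
  moreover have "c n \<noteq> c (Suc n)" for n
    using decr[of n] zero_le_dist[of "c n" a] by auto
  ultimately have "infinite_descending_chain L c"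
    using c by (auto simp: infinite_descending_chain_def)
  then show ?thesis by blast
qed

lemma finite_Int_bounded_if_no_infinite_descending_chain:
  fixes L :: "'a::heine_borel set"
  assumes "\<nexists>c. infinite_descending_chain L c" "bounded B"
  shows "finite (L \<inter> B)"
proof (rule ccontr)
  assume "infinite (L \<inter> B)"
  moreover have "compact (closure B)"
    using \<open>bounded B\<close> by (simp add: compact_closure)
  ultimately obtain a where "a islimpt (L \<inter> B)"
    using Heine_Borel_imp_Bolzano_Weierstrass[of "closure B" "L \<inter> B"] closure_subset[of B]
    by blast
  then show False
    using assms(1) limit_point_imp_infinite_descending_chain islimpt_subset[of a "L \<inter> B" L]
    by blast
qed

text \<open>A descending step of \<open>R \<union> S\<close> along \<open>R\<close> absorbs the \<open>S\<close>-steps that come after it.\<close>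

lemma wf_Un_absorb:
  assumes "wf R" "wf S" "trans S" "S O R \<subseteq> R"
  shows "wf (R \<union> S)"
proof (rule wfI_min)
  fix x :: 'a and Q assume "x \<in> Q"
  \<comment> \<open>These are the \<open>S\<close>-minimal elements of \<open>Q\<close>; an
    \<open>R\<close>-minimal one among them is minimal for the union.\<close>
  define Q' where "Q' = {q \<in> Q. \<forall>y. (y, q) \<in> S \<longrightarrow> y \<notin> Q}"
  obtain q0 where "q0 \<in> Q'"
    using wfE_min[OF \<open>wf S\<close> \<open>x \<in> Q\<close>] by (auto simp: Q'_def)
  then obtain q where q: "q \<in> Q'" "\<And>y. (y, q) \<in> R \<Longrightarrow> y \<notin> Q'"
    by (rule wfE_min[OF \<open>wf R\<close>]) blast
  have "y \<notin> Q" if "(y, q) \<in> R" for y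
  proof
    assume "y \<in> Q"
    \<comment> \<open>By transitivity an \<open>S\<close>-minimal element of \<open>T\<close> is
      \<open>S\<close>-minimal in all of \<open>Q\<close>; by absorption it is still an
      \<open>R\<close>-step below \<open>q\<close>.\<close>
    define T where "T = {z \<in> Q. z = y \<or> (z, y) \<in> S}"
    have "y \<in> T" using \<open>y \<in> Q\<close> by (simp add: T_def)
    then obtain m where m: "m \<in> T" "\<And>z. (z, m) \<in> S \<Longrightarrow> z \<notin> T"
      by (rule wfE_min[OF \<open>wf S\<close>]) blast
    then have "m \<in> Q'"
      using \<open>trans S\<close> by (auto simp: T_def Q'_def dest: transD)
    moreover have "(m, q) \<in> R"
      using m(1) that \<open>S O R \<subseteq> R\<close> by (auto simp: T_def)
    ultimately show False
      using q(2) by blast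
  qed
  then show "\<exists>z\<in>Q. \<forall>y. (y, z) \<in> R \<union> S \<longrightarrow> y \<notin> Q"
    using q(1) by (auto simp: Q'_def)
qed

lemma wf_frog_move:
  fixes L :: "'a::heine_borel set"
  assumes no_chain: "\<nexists>c. infinite_descending_chain L c"
  shows "wf {(q, p). frog_move L p q}"
proof -
  text \<open>
    A pair \<open>(v, u)\<close> stands for the position \<open>{u, v}\<close> whose resting frog is at \<open>v\<close>. The next move
    either is made by the same frog again (\<open>S\<close>), or makes \<open>u\<close> the new resting place (\<open>R\<close>).
  \<close>
  define S where "S = {((v, u'), (v, u)) | v u u'.
    v \<in> L \<and> u \<in> L \<and> u' \<in> L \<and> u' \<noteq> v \<and> dist v u' < dist v u}"
  define R where "R = {((u, v'), (v, u)) | u v v'.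
    v \<in> L \<and> u \<in> L \<and> v' \<in> L \<and> v' \<noteq> u \<and> dist u v' < dist v u}"
  have "wf S"
  proof (rule wf_subset[OF wf_measure])
    \<comment> \<open>The balls are open, so \<open>u'\<close> lies in the larger one but not in the
      smaller.\<close>
    have "card (L \<inter> ball v (dist v u')) < card (L \<inter> ball v (dist v u))"
      if "u' \<in> L" "dist v u' < dist v u" for u u' v
    proof (rule psubset_card_mono)
      show "finite (L \<inter> ball v (dist v u))"
        using finite_Int_bounded_if_no_infinite_descending_chain[OF no_chain] by simp
      show "L \<inter> ball v (dist v u') \<subset> L \<inter> ball v (dist v u)"
        using that by auto
    qed
    then show "S \<subseteq> Wellfounded.measure (\<lambda>(v, u). card (L \<inter> ball v (dist v u)))"
      by (auto simp: S_def)
  qed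
  moreover have "wf R"
    unfolding wf_iff_no_infinite_down_chain
  proof
    assume "\<exists>f. \<forall>i. (f (Suc i), f i) \<in> R"
    then obtain f where f: "\<And>i. (f (Suc i), f i) \<in> R" by blast
    have step: "snd (f i) = fst (f (Suc i)) \<and> fst (f i) \<in> L \<and>
        fst (f (Suc i)) \<noteq> snd (f (Suc i)) \<and>
        dist (fst (f (Suc i))) (snd (f (Suc i))) < dist (fst (f i)) (snd (f i))" for i
      using f[of i] by (auto simp: R_def)
    \<comment> \<open>Along \<open>R\<close> the moved frog rests next, so successive resting places
      are the two components of one pair. The shift by one is there because \<open>step\<close>
      gives distinct components only after a move.\<close>
    then have "infinite_descending_chain L (\<lambda>i. fst (f (Suc i)))"
      unfolding infinite_descending_chain_def by metis
    then show False using no_chain by blast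
  qed
  moreover have "trans S"
    by (rule transI) (auto simp: S_def)
  moreover have "S O R \<subseteq> R"
    by (auto simp: S_def R_def)
  ultimately have wf: "wf (R \<union> S)"
    by (intro wf_Un_absorb)
  have no_play: False if f: "\<And>i. frog_move L (f i) (f (Suc i))" for f
  proof -
    have succ: "\<exists>z. f (Suc n) = {fst z, snd z} \<and> (z, w) \<in> R \<union> S"
      if w: "f n = {fst w, snd w}" for w n
    proof -
      obtain x y z where xyz: "x \<in> L" "y \<in> L" "f n = {x, y}" "z \<in> L" "z \<noteq> y"
          "f (Suc n) = {z, y}" "dist z y < dist x y"
        using f[of n] unfolding frog_move_def by blast
      \<comment> \<open>The frog at \<open>x\<close> moves and \<open>y\<close> is the resting
        place: an \<open>R\<close>-step if \<open>x\<close> rested before, an \<open>S\<close>-step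
        if \<open>y\<close> did.\<close>
      then have "w = (x, y) \<or> w = (y, x)"
        using w by (cases w) (auto simp: doubleton_eq_iff)
      then have "((y, z), w) \<in> R \<union> S"
        using xyz by (auto simp: R_def S_def dist_commute)
      then show ?thesis
        using xyz(6) by (intro exI[of _ "(y, z)"]) auto
    qed
    have "\<exists>g. \<forall>n. f n = {fst (g n), snd (g n)} \<and> (g (Suc n), g n) \<in> R \<union> S"
    proof (rule dependent_nat_choice)
      \<comment> \<open>No frog has rested yet, so either order of the starting pair will
        do.\<close>
      obtain x y where "f 0 = {x, y}"
        using f[of 0] unfolding frog_move_def by blast
      then show "\<exists>w. f 0 = {fst w, snd w}"
        by (intro exI[of _ "(x, y)"]) simp
    qed (use succ in blast)
    then show False
      using wf unfolding wf_iff_no_infinite_down_chain by blast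
  qed
  show ?thesis
    unfolding wf_iff_no_infinite_down_chain using no_play by auto
qed

section \<open>Stable matchings as kernels\<close>

lemma frog_move_point_pairs:
  assumes "frog_move L p q"
  shows "q \<in> point_pairs L"
  using assms unfolding frog_move_def point_pairs_def by blast

lemma matching_pair_eq:
  assumes "matching L M" "e \<in> M" "f \<in> M" "x \<in> L" "x \<in> e" "x \<in> f"
  shows "e = f"
  using assms by (simp add: matching_def)

text \<open>A real bound excludes the value \<infinity> of an unmatched point, and in a matching the
  partner is unique, which evaluates the \<open>THE\<close>.\<close>

lemma match_dist_le_imp_partner:
  assumes "matching L M" "x \<in> L" "match_dist M x \<le> ereal r"
  obtains z where "{x, z} \<in> M" "dist x z \<le> r"
proof (cases "\<exists>z. {x, z} \<in> M")
  case True
  then obtain z where z: "{x, z} \<in> M" by blast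
  have "(THE z. {x, z} \<in> M) = z"
  proof (rule the_equality)
    show "z' = z" if "{x, z'} \<in> M" for z'
    proof -
      have "{x, z'} = {x, z}"
        using matching_pair_eq[OF assms(1) that z assms(2)] by simp
      then show ?thesis by (auto simp: doubleton_eq_iff)
    qed
  qed (rule z)
  then have "dist x z \<le> r"
    using assms(3) True by (simp add: match_dist_def partner_def)
  then show ?thesis using z that by blast
next
  case False
  then show ?thesis
    using assms(3) by (simp add: match_dist_def partner_def)
qed

lemma frog_move_from_matched:
  assumes "matching L M" "p \<in> M" "frog_move L p q"
  shows "q \<notin> M"
proof
  assume "q \<in> M"
  obtain x y z where "y \<in> L" "p = {x, y}" "q = {z, y}" "dist z y < dist x y"
    using assms(3) unfolding frog_move_def by blast
  moreover from this have "p = q"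
    using matching_pair_eq[OF assms(1,2) \<open>q \<in> M\<close> \<open>y \<in> L\<close>] by simp
  ultimately show False by (auto simp: doubleton_eq_iff)
qed

text \<open>As the pair is not unstable, one of its points has a partner at most as far away as the
  other point; the frog at that other point jumps to the partner.\<close>

lemma frog_move_to_matched:
  assumes dd: "distinct_distances L" and stable: "stable_matching L M"
    and "p \<in> point_pairs L" "p \<notin> M"
  shows "\<exists>q\<in>M. frog_move L p q"
proof -
  obtain a b where ab: "a \<in> L" "b \<in> L" "a \<noteq> b" "p = {a, b}"
    using assms(3) unfolding point_pairs_def by auto
  moreover have "match_dist M a \<le> ereal (dist a b) \<or> match_dist M b \<le> ereal (dist a b)"
    using stable ab unfolding stable_matching_def unstable_pair_def not_less[symmetric] by auto
  ultimately obtain x y where xy: "x \<in> L" "y \<in> L" "x \<noteq> y" "p = {x, y}"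
      and le: "match_dist M y \<le> ereal (dist x y)"
    using that[of a b] that[of b a] by (auto simp: dist_commute insert_commute)
  have M: "matching L M" using stable by (simp add: stable_matching_def)
  then obtain z where z: "{y, z} \<in> M" "dist y z \<le> dist x y"
    using match_dist_le_imp_partner[OF _ xy(2) le] by blast
  have "z \<in> L" "z \<noteq> y"
    using M z(1) by (auto simp: matching_def point_pairs_def doubleton_eq_iff)
  moreover have "z \<noteq> x"
    using z(1) \<open>p \<notin> M\<close> xy by (auto simp: insert_commute)
  \<comment> \<open>Stability gives only a weak inequality; distinct distances make it strict, as a
    move requires.\<close>
  moreover from calculation have "dist z y \<noteq> dist x y"
    using dd xy unfolding distinct_distances_def by (metis doubleton_eq_iff)
  ultimately have "frog_move L p {z, y}"
    using xy z(2) unfolding frog_move_def by (metis dist_commute order_le_less)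
  then show ?thesis
    using z(1) by (auto simp: insert_commute)
qed

theorem proposition3:
  fixes L :: "(real ^ 'd) set" and M :: "(real ^ 'd) set set" and x y :: "real ^ 'd"
  assumes "distinct_distances L"
    and "\<nexists>c. infinite_descending_chain L c"
    and "stable_matching L M"
    and "x \<in> L" and "y \<in> L" and "x \<noteq> y"
  shows "P_position L {x, y} \<longleftrightarrow> {x, y} \<in> M"
proof -
  have M: "matching L M"
    using assms(3) by (simp add: stable_matching_def)
  have pair: "{x, y} \<in> point_pairs L"
    using assms(4-6) by (auto simp: point_pairs_def)
  note kernel = wf_frog_move[OF assms(2)] frog_move_point_pairs
    frog_move_from_matched[OF M] frog_move_to_matched[OF assms(1,3)]
  have "\<exists>\<sigma>. wins_second (frog_move L) {x, y} \<sigma>" if "{x, y} \<in> M"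
    by (rule wins_second_in_kernel[where D = "point_pairs L" and K = M])
      (use kernel pair that in blast)+
  moreover have "\<not> wins_second (frog_move L) {x, y} \<sigma>" if "{x, y} \<notin> M" for \<sigma>
    by (rule not_wins_second_outside_kernel[where D = "point_pairs L" and K = M])
      (use kernel pair that in blast)+
  ultimately show ?thesis
    using pair by (auto simp: P_position_def)
qed

end
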